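(* Let $\mathsf{appendV}$ be the vector append program, a closed Cedille term of type $\forall A{:}\star.\ \forall n{:}\mathsf{Nat}.\ \mathsf{Vec}\cdot A\ n\to\forall m{:}\mathsf{Nat}.\ \mathsf{Vec}\cdot A\ m\to\mathsf{Vec}\cdot A\ (\mathsf{add}\ n\ m)$, and define list append by reuse, $\mathsf{appendL}:\forall A{:}\star.\ \mathsf{List}\cdot A\to\mathsf{List}\cdot A\to\mathsf{List}\cdot A$, $$\mathsf{appendL}=\Lambda A.\lambda xs.\lambda ys.\ \mathsf{v2l}\cdot A\ {-}(\mathsf{add}\ (\mathsf{length}\cdot A\ xs)\ (\mathsf{length}\cdot A\ ys))\ \bigl(\mathsf{appendV}\cdot A\ {-}(\mathsf{length}\cdot A\ xs)\ (\mathsf{l2v}\cdot A\ xs)\ {-}(\mathsf{length}\cdot A\ ys)\ (\mathsf{l2v}\cdot A\ ys)\bigr).$$ Then the erasure of $\mathsf{appendL}$ is the erasure of $\mathsf{appendV}$: $|\mathsf{appendL}| =_{\alpha\beta\eta} |\mathsf{appendV}|$.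
   Context: **Terms and erasure.** Terms are those of Cedille (type theory $\iota\lambda P2$), a type-annotated Curry-style dependent type theory. $\star$ is the kind of types; $\lambda x.\,t$ and $t\ t'$ are explicit abstraction and application (types $\Pi x{:}T.\,T'$, or $T\to T'$); $\Lambda x.\,t$ is implicit (erased) abstraction over a value or a type (types $\forall x{:}T.\,T'$, or $T\Rightarrow T'$ if non-dependent), with implicit value application $t\ {-}t'$ and type application $t\cdot T$; $[t,t']$, $t.1$, $t.2$ are the introduction and projections of the dependent intersection type $\iota x{:}T.\,T'$; $\beta$ and $\beta\{t\}$ are reflexivity proofs of the heterogeneous equality type $t_1\simeq t_2$; $\rho\ q - t$ is $t$ with its type rewritten by the equality proof $q$; $\varsigma\ q$ is symmetry of $q$. Erasure $|\cdot|$ maps annotated terms to untyped $\lambda$-terms: $|x|=x$, $|\lambda x.t|=\lambda x.|t|$, $|t\ t'|=|t|\ |t'|$, $|\Lambda x.t|=|t|$, $|t\ {-}t'|=|t|$, $|t\cdot T|=|t|$, $|[t,t']|=|t|$, $|t.1|=|t.2|=|t|$, $|\beta\{t\}|=|t|$, $|\beta|=\lambda x.x$, $|\rho\ q - t|=|t|$. Defined constants are unfolded. Erased terms are compared up to $\alpha\beta\eta$-equality. Type information does not affect erasure. **Lists.** $\mathsf{ListC}\cdot A=\forall X{:}\star.\ X\to(A\to X\to X)\to X$; $\mathsf{nilCL}=\Lambda A,X.\lambda c_N,c_C.\,c_N$; $\mathsf{consCL}=\Lambda A.\lambda x,xs.\Lambda X.\lambda c_N,c_C.\ c_C\ x\ (xs\cdot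 X\ c_N\ c_C)$; $\mathsf{ListP}\cdot A\ xsC=\forall X{:}\star.\forall P{:}X\to\star.\forall c_N{:}X.\forall c_C{:}A\to X\to X.\ P\ c_N\to(\forall xs{:}X.\Pi x{:}A.\ P\ xs\to P(c_C\ x\ xs))\to P(xsC\cdot X\ c_N\ c_C)$; $\mathsf{ListR}\cdot A\ xsC=(xsC\cdot(\mathsf{ListC}\cdot A)\ \mathsf{nilCL}\ \mathsf{consCL}\simeq xsC)$; $\mathsf{List}\cdot A=\iota xs{:}(\iota xsC{:}\mathsf{ListC}\cdot A.\ \mathsf{ListP}\cdot A\ xsC).\ \mathsf{ListR}\cdot A\ xs.1$. Helper: $\mathsf{mkList}=\Lambda A.\lambda xs.\Lambda q.\,[xs,\ \rho\ q-\beta\{xs\}]$ of type $\forall A.\Pi xs{:}(\iota xsC{:}\mathsf{ListC}\cdot A.\mathsf{ListP}\cdot A\ xsC).\ \mathsf{ListR}\cdot A\ xs.1\Rightarrow\mathsf{List}\cdot A$. With $\mathsf{nilL},\mathsf{consL}$ the constructors of $\mathsf{List}$, the eliminator $\mathsf{elimList}:\forall A.\Pi xs{:}\mathsf{List}\cdot A.\forall P{:}\mathsf{List}\cdot A\to\star.\ P(\mathsf{nilL}\cdot A)\to(\forall xs{:}\mathsf{List}\cdot A.\Pi x{:}A.\ P\ xs\to P(\mathsf{consL}\cdot A\ x\ xs))\to P\ xs$ is $\Lambda A.\lambda xs.\Lambda P.\ \rho\ (\varsigma\ xs.2)-(xs.1.2\cdot(\mathsf{List}\cdot A)\cdot P\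 {-}(\mathsf{nilL}\cdot A)\ {-}(\mathsf{consL}\cdot A))$. $\mathsf{length}:\forall A{:}\star.\mathsf{List}\cdot A\to\mathsf{Nat}$ is the usual length function. **Vectors.** $\mathsf{Nat}$ is the type of naturals with $\mathsf{zero},\mathsf{suc}$ and addition $\mathsf{add}$. $\mathsf{VecC}\cdot A\ n=\forall X{:}\mathsf{Nat}\to\star.\ X\ \mathsf{zero}\to(\forall n{:}\mathsf{Nat}.\ A\to X\ n\to X(\mathsf{suc}\ n))\to X\ n$; $\mathsf{nilCV}=\Lambda A,X.\lambda c_N,c_C.\,c_N$; $\mathsf{consCV}=\Lambda A,n.\lambda x,xs.\Lambda X.\lambda c_N,c_C.\ c_C\ {-}n\ x\ (xs\cdot X\ c_N\ c_C)$; $\mathsf{VecP}\cdot A\ n\ xsC=\forall X{:}\mathsf{Nat}\to\star.\forall P{:}\Pi n{:}\mathsf{Nat}.X\ n\to\star.\forall c_N{:}X\ \mathsf{zero}.\forall c_C{:}(\forall n{:}\mathsf{Nat}.A\to X\ n\to X(\mathsf{suc}\ n)).\ P\ \mathsf{zero}\ c_N\to(\forall n{:}\mathsf{Nat}.\forall xs{:}X\ n.\Pi x{:}A.\ P\ n\ xs\to P(\mathsf{suc}\ n)(c_C\ {-}n\ x\ xs))\to P\ n\ (xsC\cdot X\ c_N\ c_C)$; $\mathsf{VecR}\cdot A\ n\ xsC=(xsC\cdot(\mathsf{VecC}\cdot A)\ \mathsf{nilCV}\ \mathsf{consCV}\simeq xsC)$; $\mathsf{Vec}\cdot A\ n=\iota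 xs{:}(\iota xsC{:}\mathsf{VecC}\cdot A\ n.\ \mathsf{VecP}\cdot A\ n\ xsC).\ \mathsf{VecR}\cdot A\ n\ xs.1$. Helper: $\mathsf{mkVec}=\Lambda A.\Lambda n.\lambda xs.\Lambda q.\,[xs,\ \rho\ q-\beta\{xs\}]$ of type $\forall A.\forall n.\Pi xs{:}(\iota xsC{:}\mathsf{VecC}\cdot A\ n.\mathsf{VecP}\cdot A\ n\ xsC).\ \mathsf{VecR}\cdot A\ n\ xs.1\Rightarrow\mathsf{Vec}\cdot A\ n$. **Coercion $\mathsf{v2l}$** of type $\forall A.\forall n.\ \mathsf{Vec}\cdot A\ n\to\mathsf{List}\cdot A$. $\mathsf{v2lC}=\Lambda A.\Lambda n.\lambda xs.\Lambda X.\lambda c_N.\lambda c_C.\ xs.1.1\cdot(\lambda\_{:}\mathsf{Nat}.X)\ c_N\ (\Lambda\_.\,c_C)$; $\mathsf{v2lP}=\Lambda A.\Lambda n.\lambda xs.\Lambda X.\Lambda P.\Lambda c_N.\Lambda c_C.\lambda p_N.\lambda p_C.\ xs.1.2\cdot(\lambda\_{:}\mathsf{Nat}.X)\cdot(\lambda\_{:}\mathsf{Nat}.P)\ {-}c_N\ {-}(\Lambda\_.\,c_C)\ p_N\ (\Lambda\_.\,p_C)$; $\mathsf{v2lR}=\Lambda A.\Lambda n.\lambda xs.\ xs.2$; $\mathsf{v2l}=\Lambda A.\Lambda n.\lambda xs.\ \mathsf{mkList}\cdot A\ [\mathsf{v2lC}\cdot A\ {-}n\ xs,\ \mathsf{v2lP}\cdot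 A\ {-}n\ xs]\ {-}(\mathsf{v2lR}\cdot A\ {-}n\ xs)$. **Coercion $\mathsf{l2v}$** of type $\forall A.\Pi xs{:}\mathsf{List}\cdot A.\ \mathsf{Vec}\cdot A\ (\mathsf{length}\cdot A\ xs)$. $\mathsf{l2vC}=\Lambda A.\lambda xs.\Lambda X.\lambda c_N.\lambda c_C.\ \mathsf{elimList}\cdot A\ xs\cdot(\lambda xs{:}\mathsf{List}\cdot A.\ X(\mathsf{length}\cdot A\ xs))\ c_N\ (\Lambda xs.\ c_C\ {-}(\mathsf{length}\cdot A\ xs))$; $\mathsf{l2vP}=\Lambda A.\lambda xs.\Lambda X.\Lambda P.\Lambda c_N.\Lambda c_C.\lambda p_N.\lambda p_C.\ \mathsf{elimList}\cdot A\ xs\cdot(\lambda xs{:}\mathsf{List}\cdot A.\ P(\mathsf{length}\cdot A\ xs)(\mathsf{l2vC}\cdot A\ xs\cdot X\ c_N\ c_C))\ p_N\ (\Lambda xs.\ p_C\ {-}(\mathsf{length}\cdot A\ xs)\ {-}(\mathsf{l2vC}\cdot A\ xs\cdot X\ c_N\ c_C))$; $\mathsf{l2vR}=\Lambda A.\lambda xs.\ xs.2$; $\mathsf{l2v}=\Lambda A.\lambda xs.\ \mathsf{mkVec}\cdot A\ {-}(\mathsf{length}\cdot A\ xs)\ [\mathsf{l2vC}\cdot A\ xs,\ \mathsf{l2vP}\cdot A\ xs]\ {-}(\mathsf{l2vR}\cdot A\ xs)$. *)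

theory Defs
  imports Main
begin

section \<open>Untyped lambda-terms up to alpha-beta-eta\<close>

type_synonym name = string

text \<open>\<open>variant x C\<close> keeps the bound name \<open>x\<close> unless that would capture a variable in \<open>C\<close>.\<close>

definition variant :: "name \<Rightarrow> name set \<Rightarrow> name" where
  "variant x C = (if x \<notin> C then x else SOME y. y \<notin> C)"

datatype lam =
    LVar name
  | LLam name lam
  | LApp lam lam

primrec fv_lam :: "lam \<Rightarrow> name set" where
  "fv_lam (LVar x) = {x}"
| "fv_lam (LLam x t) = fv_lam t - {x}"
| "fv_lam (LApp t u) = fv_lam t \<union> fv_lam u"

text \<open>Capture-avoiding simultaneous substitution; \<open>t[u/x]\<close> is \<open>sub_lam t (LVar(x := u))\<close>.\<close>

primrec sub_lam :: "lam \<Rightarrow> (name \<Rightarrow> lam) \<Rightarrow> lam" where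
  "sub_lam (LVar x) \<sigma> = \<sigma> x"
| "sub_lam (LLam x t) \<sigma> =
     (let y = variant x (\<Union>z \<in> fv_lam t - {x}. fv_lam (\<sigma> z))
      in LLam y (sub_lam t (\<sigma>(x := LVar y))))"
| "sub_lam (LApp t u) \<sigma> = LApp (sub_lam t \<sigma>) (sub_lam u \<sigma>)"

inductive abe_eq :: "lam \<Rightarrow> lam \<Rightarrow> bool" (infix "=\<^sub>\<alpha>\<^sub>\<beta>\<^sub>\<eta>" 50) where
  abe_refl: "t =\<^sub>\<alpha>\<^sub>\<beta>\<^sub>\<eta> t"
| abe_sym: "t =\<^sub>\<alpha>\<^sub>\<beta>\<^sub>\<eta> u \<Longrightarrow> u =\<^sub>\<alpha>\<^sub>\<beta>\<^sub>\<eta> t"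
| abe_trans: "t =\<^sub>\<alpha>\<^sub>\<beta>\<^sub>\<eta> u \<Longrightarrow> u =\<^sub>\<alpha>\<^sub>\<beta>\<^sub>\<eta> v \<Longrightarrow> t =\<^sub>\<alpha>\<^sub>\<beta>\<^sub>\<eta> v"
| abe_lam: "t =\<^sub>\<alpha>\<^sub>\<beta>\<^sub>\<eta> t' \<Longrightarrow> LLam x t =\<^sub>\<alpha>\<^sub>\<beta>\<^sub>\<eta> LLam x t'"
| abe_app: "t =\<^sub>\<alpha>\<^sub>\<beta>\<^sub>\<eta> t' \<Longrightarrow> u =\<^sub>\<alpha>\<^sub>\<beta>\<^sub>\<eta> u' \<Longrightarrow> LApp t u =\<^sub>\<alpha>\<^sub>\<beta>\<^sub>\<eta> LApp t' u'"
| abe_alpha: "y \<notin> fv_lam (LLam x t) \<Longrightarrow> LLam x t =\<^sub>\<alpha>\<^sub>\<beta>\<^sub>\<eta> LLam y (sub_lam t (LVar(x := LVar y)))"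
| abe_beta: "LApp (LLam x t) u =\<^sub>\<alpha>\<^sub>\<beta>\<^sub>\<eta> sub_lam t (LVar(x := u))"
| abe_eta: "x \<notin> fv_lam t \<Longrightarrow> LLam x (LApp t (LVar x)) =\<^sub>\<alpha>\<^sub>\<beta>\<^sub>\<eta> t"


section \<open>Annotated syntax and erasure\<close>

text \<open>
  Explicit abstraction and application are \<open>\<^bold>\<lambda>x. t\<close> and \<open>t \<^bold>@ t'\<close>; implicit ones are
  \<open>\<^bold>\<Lambda>x. t\<close> and \<open>t \<^bold>- t'\<close> for values, \<open>\<^bold>\<Lambda>\<^sub>TX. t\<close> and \<open>t \<^bold>\<cdot> T\<close> for types.
  The subscript \<open>T\<close> marks forms that bind a type variable or take a type argument, \<open>t\<close> marks
  the type-level forms that bind a term variable or take a term argument.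
  Term and type variables live in separate name spaces.
\<close>

datatype trm =
    Var name
  | Lam name trm                  ("(\<^bold>\<lambda>_./ _)" [1000, 10] 10)
  | App trm trm                   (infixl "\<^bold>@" 90)
  | ILam name trm                 ("(\<^bold>\<Lambda>_./ _)" [1000, 10] 10)
  | IApp trm trm                  (infixl "\<^bold>-" 90)
  | TLam name trm                 ("(\<^bold>\<Lambda>\<^sub>T_./ _)" [1000, 10] 10)
  | TApp trm ty                  (infixl "\<^bold>\<cdot>" 90)
  | Pair trm trm                  ("\<^bold>[_,/ _\<^bold>]")
  | Proj1 trm                     ("_\<^bold>.\<^bold>1" [1000] 1000)
  | Proj2 trm                     ("_\<^bold>.\<^bold>2" [1000] 1000)
  | Beta                          ("\<^bold>\<beta>")
  | BetaAt trm                    ("\<^bold>\<beta>\<^bold>{_\<^bold>}")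
  | Rho trm trm                   ("(\<^bold>\<rho> _ \<^bold>\<midarrow>/ _)" [91, 10] 10)
  | Sym trm                       ("\<^bold>\<sigma> _" [91] 91)
and ty =
    TVar name
  | Pi name ty ty               ("(\<^bold>\<Pi>_\<^bold>:_./ _)" [1000, 11, 10] 10)
  | All name ty ty              ("(\<^bold>\<forall>_\<^bold>:_./ _)" [1000, 11, 10] 10)
  | TAll name knd ty             ("(\<^bold>\<forall>\<^sub>T_\<^bold>:_./ _)" [1000, 11, 10] 10)
  | Iota name ty ty             ("(\<^bold>\<iota>_\<^bold>:_./ _)" [1000, 11, 10] 10)
  | Equal trm trm                 (infix "\<^bold>\<simeq>" 50)
  | TyLam name ty ty            ("(\<^bold>\<lambda>\<^sub>t_\<^bold>:_./ _)" [1000, 11, 10] 10)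
  | TyApp ty trm                 (infixl "\<^bold>@\<^sub>t" 90)
  | TyTLam name knd ty           ("(\<^bold>\<lambda>\<^sub>T_\<^bold>:_./ _)" [1000, 11, 10] 10)
  | TyTApp ty ty                (infixl "\<^bold>\<cdot>\<^sub>T" 90)
and knd =
    Star                          ("\<^bold>\<star>")
  | KPi name ty knd              ("(\<^bold>\<Pi>\<^sub>t_\<^bold>:_./ _)" [1000, 11, 10] 10)
  | KTPi name knd knd             ("(\<^bold>\<Pi>\<^sub>T_\<^bold>:_./ _)" [1000, 11, 10] 10)

text \<open>Non-dependent arrows bind the name \<open>_\<close>, which never occurs as a variable.\<close>

abbreviation Arr :: "ty \<Rightarrow> ty \<Rightarrow> ty" (infixr "\<^bold>\<rightarrow>" 20) where
  "T \<^bold>\<rightarrow> T' \<equiv> Pi ''_'' T T'"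

abbreviation KArr :: "ty \<Rightarrow> knd \<Rightarrow> knd" (infixr "\<^bold>\<rightarrow>\<^sub>k" 20) where
  "T \<^bold>\<rightarrow>\<^sub>k \<kappa> \<equiv> KPi ''_'' T \<kappa>"

primrec erase :: "trm \<Rightarrow> lam" ("\<^bold>|_\<^bold>|") where
  "\<^bold>|Var x\<^bold>| = LVar x"
| "\<^bold>|Lam x t\<^bold>| = LLam x \<^bold>|t\<^bold>|"
| "\<^bold>|App t t'\<^bold>| = LApp \<^bold>|t\<^bold>| \<^bold>|t'\<^bold>|"
| "\<^bold>|ILam x t\<^bold>| = \<^bold>|t\<^bold>|"
| "\<^bold>|IApp t t'\<^bold>| = \<^bold>|t\<^bold>|"
| "\<^bold>|TLam X t\<^bold>| = \<^bold>|t\<^bold>|"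
| "\<^bold>|TApp t T\<^bold>| = \<^bold>|t\<^bold>|"
| "\<^bold>|Pair t t'\<^bold>| = \<^bold>|t\<^bold>|"
| "\<^bold>|Proj1 t\<^bold>| = \<^bold>|t\<^bold>|"
| "\<^bold>|Proj2 t\<^bold>| = \<^bold>|t\<^bold>|"
| "\<^bold>|Beta\<^bold>| = LLam ''x'' (LVar ''x'')"
| "\<^bold>|BetaAt t\<^bold>| = \<^bold>|t\<^bold>|"
| "\<^bold>|Rho q t\<^bold>| = \<^bold>|t\<^bold>|"
| "\<^bold>|Sym q\<^bold>| = \<^bold>|q\<^bold>|"


section \<open>Free variables and substitution\<close>

datatype var = TmV name | TyV name

primrec fv_trm :: "trm \<Rightarrow> var set" and fv_typ :: "ty \<Rightarrow> var set"
  and fv_knd :: "knd \<Rightarrow> var set" where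
  "fv_trm (Var x) = {TmV x}"
| "fv_trm (Lam x t) = fv_trm t - {TmV x}"
| "fv_trm (App t t') = fv_trm t \<union> fv_trm t'"
| "fv_trm (ILam x t) = fv_trm t - {TmV x}"
| "fv_trm (IApp t t') = fv_trm t \<union> fv_trm t'"
| "fv_trm (TLam X t) = fv_trm t - {TyV X}"
| "fv_trm (TApp t T) = fv_trm t \<union> fv_typ T"
| "fv_trm (Pair t t') = fv_trm t \<union> fv_trm t'"
| "fv_trm (Proj1 t) = fv_trm t"
| "fv_trm (Proj2 t) = fv_trm t"
| "fv_trm Beta = {}"
| "fv_trm (BetaAt t) = fv_trm t"
| "fv_trm (Rho q t) = fv_trm q \<union> fv_trm t"
| "fv_trm (Sym q) = fv_trm q"
| "fv_typ (TVar X) = {TyV X}"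
| "fv_typ (Pi x T T') = fv_typ T \<union> (fv_typ T' - {TmV x})"
| "fv_typ (All x T T') = fv_typ T \<union> (fv_typ T' - {TmV x})"
| "fv_typ (TAll X \<kappa> T) = fv_knd \<kappa> \<union> (fv_typ T - {TyV X})"
| "fv_typ (Iota x T T') = fv_typ T \<union> (fv_typ T' - {TmV x})"
| "fv_typ (Equal t t') = fv_trm t \<union> fv_trm t'"
| "fv_typ (TyLam x T T') = fv_typ T \<union> (fv_typ T' - {TmV x})"
| "fv_typ (TyApp T t) = fv_typ T \<union> fv_trm t"
| "fv_typ (TyTLam X \<kappa> T) = fv_knd \<kappa> \<union> (fv_typ T - {TyV X})"
| "fv_typ (TyTApp T T') = fv_typ T \<union> fv_typ T'"
| "fv_knd Star = {}"
| "fv_knd (KPi x T \<kappa>) = fv_typ T \<union> (fv_knd \<kappa> - {TmV x})"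
| "fv_knd (KTPi X \<kappa> \<kappa>') = fv_knd \<kappa> \<union> (fv_knd \<kappa>' - {TyV X})"

text \<open>
  \<open>well_erased t\<close>: no variable bound by \<open>\<^bold>\<Lambda>\<close> occurs in the erasure of its scope. Only the subterms that
  survive erasure matter.
\<close>

primrec well_erased :: "trm \<Rightarrow> bool" where
  "well_erased (Var x) = True"
| "well_erased (Lam x t) = well_erased t"
| "well_erased (App t t') = (well_erased t \<and> well_erased t')"
| "well_erased (ILam x t) = (x \<notin> fv_lam \<^bold>|t\<^bold>| \<and> well_erased t)"
| "well_erased (IApp t t') = well_erased t"
| "well_erased (TLam X t) = well_erased t"
| "well_erased (TApp t T) = well_erased t"
| "well_erased (Pair t t') = well_erased t"
| "well_erased (Proj1 t) = well_erased t"
| "well_erased (Proj2 t) = well_erased t"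
| "well_erased Beta = True"
| "well_erased (BetaAt t) = well_erased t"
| "well_erased (Rho q t) = well_erased t"
| "well_erased (Sym q) = well_erased q"

definition closed :: "trm \<Rightarrow> bool" where
  "closed t \<longleftrightarrow> fv_trm t = {}"

text \<open>
  Capture-avoiding simultaneous substitution of terms for term variables (\<open>\<sigma>\<close>) and types for type
  variables (\<open>\<tau>\<close>). \<open>img V \<sigma> \<tau>\<close> collects the free variables of the images of \<open>V\<close>; \<open>tm_variant\<close> and
  \<open>ty_variant\<close> choose a bound name that avoids them.
\<close>

definition img :: "var set \<Rightarrow> (name \<Rightarrow> trm) \<Rightarrow> (name \<Rightarrow> ty) \<Rightarrow> var set" where
  "img V \<sigma> \<tau> = (\<Union>v \<in> V. case v of TmV x \<Rightarrow> fv_trm (\<sigma> x) | TyV X \<Rightarrow> fv_typ (\<tau> X))"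

definition tm_variant :: "name \<Rightarrow> var set \<Rightarrow> name" where
  "tm_variant x C = variant x {y. TmV y \<in> C}"

definition ty_variant :: "name \<Rightarrow> var set \<Rightarrow> name" where
  "ty_variant X C = variant X {Y. TyV Y \<in> C}"

primrec sub_trm :: "trm \<Rightarrow> (name \<Rightarrow> trm) \<Rightarrow> (name \<Rightarrow> ty) \<Rightarrow> trm"
  and sub_typ :: "ty \<Rightarrow> (name \<Rightarrow> trm) \<Rightarrow> (name \<Rightarrow> ty) \<Rightarrow> ty"
  and sub_knd :: "knd \<Rightarrow> (name \<Rightarrow> trm) \<Rightarrow> (name \<Rightarrow> ty) \<Rightarrow> knd" where
  "sub_trm (Var x) \<sigma> \<tau> = \<sigma> x"
| "sub_trm (Lam x t) \<sigma> \<tau> =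
     (let y = tm_variant x (img (fv_trm t - {TmV x}) \<sigma> \<tau>)
      in Lam y (sub_trm t (\<sigma>(x := Var y)) \<tau>))"
| "sub_trm (App t t') \<sigma> \<tau> = App (sub_trm t \<sigma> \<tau>) (sub_trm t' \<sigma> \<tau>)"
| "sub_trm (ILam x t) \<sigma> \<tau> =
     (let y = tm_variant x (img (fv_trm t - {TmV x}) \<sigma> \<tau>)
      in ILam y (sub_trm t (\<sigma>(x := Var y)) \<tau>))"
| "sub_trm (IApp t t') \<sigma> \<tau> = IApp (sub_trm t \<sigma> \<tau>) (sub_trm t' \<sigma> \<tau>)"
| "sub_trm (TLam X t) \<sigma> \<tau> =
     (let Y = ty_variant X (img (fv_trm t - {TyV X}) \<sigma> \<tau>)
      in TLam Y (sub_trm t \<sigma> (\<tau>(X := TVar Y))))"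
| "sub_trm (TApp t T) \<sigma> \<tau> = TApp (sub_trm t \<sigma> \<tau>) (sub_typ T \<sigma> \<tau>)"
| "sub_trm (Pair t t') \<sigma> \<tau> = Pair (sub_trm t \<sigma> \<tau>) (sub_trm t' \<sigma> \<tau>)"
| "sub_trm (Proj1 t) \<sigma> \<tau> = Proj1 (sub_trm t \<sigma> \<tau>)"
| "sub_trm (Proj2 t) \<sigma> \<tau> = Proj2 (sub_trm t \<sigma> \<tau>)"
| "sub_trm Beta \<sigma> \<tau> = Beta"
| "sub_trm (BetaAt t) \<sigma> \<tau> = BetaAt (sub_trm t \<sigma> \<tau>)"
| "sub_trm (Rho q t) \<sigma> \<tau> = Rho (sub_trm q \<sigma> \<tau>) (sub_trm t \<sigma> \<tau>)"
| "sub_trm (Sym q) \<sigma> \<tau> = Sym (sub_trm q \<sigma> \<tau>)"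
| "sub_typ (TVar X) \<sigma> \<tau> = \<tau> X"
| "sub_typ (Pi x T T') \<sigma> \<tau> =
     (let y = tm_variant x (img (fv_typ T' - {TmV x}) \<sigma> \<tau>)
      in Pi y (sub_typ T \<sigma> \<tau>) (sub_typ T' (\<sigma>(x := Var y)) \<tau>))"
| "sub_typ (All x T T') \<sigma> \<tau> =
     (let y = tm_variant x (img (fv_typ T' - {TmV x}) \<sigma> \<tau>)
      in All y (sub_typ T \<sigma> \<tau>) (sub_typ T' (\<sigma>(x := Var y)) \<tau>))"
| "sub_typ (TAll X \<kappa> T) \<sigma> \<tau> =
     (let Y = ty_variant X (img (fv_typ T - {TyV X}) \<sigma> \<tau>)
      in TAll Y (sub_knd \<kappa> \<sigma> \<tau>) (sub_typ T \<sigma> (\<tau>(X := TVar Y))))"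
| "sub_typ (Iota x T T') \<sigma> \<tau> =
     (let y = tm_variant x (img (fv_typ T' - {TmV x}) \<sigma> \<tau>)
      in Iota y (sub_typ T \<sigma> \<tau>) (sub_typ T' (\<sigma>(x := Var y)) \<tau>))"
| "sub_typ (Equal t t') \<sigma> \<tau> = Equal (sub_trm t \<sigma> \<tau>) (sub_trm t' \<sigma> \<tau>)"
| "sub_typ (TyLam x T T') \<sigma> \<tau> =
     (let y = tm_variant x (img (fv_typ T' - {TmV x}) \<sigma> \<tau>)
      in TyLam y (sub_typ T \<sigma> \<tau>) (sub_typ T' (\<sigma>(x := Var y)) \<tau>))"
| "sub_typ (TyApp T t) \<sigma> \<tau> = TyApp (sub_typ T \<sigma> \<tau>) (sub_trm t \<sigma> \<tau>)"
| "sub_typ (TyTLam X \<kappa> T) \<sigma> \<tau> =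
     (let Y = ty_variant X (img (fv_typ T - {TyV X}) \<sigma> \<tau>)
      in TyTLam Y (sub_knd \<kappa> \<sigma> \<tau>) (sub_typ T \<sigma> (\<tau>(X := TVar Y))))"
| "sub_typ (TyTApp T T') \<sigma> \<tau> = TyTApp (sub_typ T \<sigma> \<tau>) (sub_typ T' \<sigma> \<tau>)"
| "sub_knd Star \<sigma> \<tau> = Star"
| "sub_knd (KPi x T \<kappa>) \<sigma> \<tau> =
     (let y = tm_variant x (img (fv_knd \<kappa> - {TmV x}) \<sigma> \<tau>)
      in KPi y (sub_typ T \<sigma> \<tau>) (sub_knd \<kappa> (\<sigma>(x := Var y)) \<tau>))"
| "sub_knd (KTPi X \<kappa> \<kappa>') \<sigma> \<tau> =
     (let Y = ty_variant X (img (fv_knd \<kappa>' - {TyV X}) \<sigma> \<tau>)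
      in KTPi Y (sub_knd \<kappa> \<sigma> \<tau>) (sub_knd \<kappa>' \<sigma> (\<tau>(X := TVar Y))))"

abbreviation trm_tm :: "trm \<Rightarrow> trm \<Rightarrow> name \<Rightarrow> trm" ("_[_'/_]\<^sub>e" [1000, 0, 0] 1000) where
  "t[s/x]\<^sub>e \<equiv> sub_trm t (Var(x := s)) TVar"
abbreviation typ_tm :: "ty \<Rightarrow> trm \<Rightarrow> name \<Rightarrow> ty" ("_[_'/_]\<^sub>t" [1000, 0, 0] 1000) where
  "T[s/x]\<^sub>t \<equiv> sub_typ T (Var(x := s)) TVar"
abbreviation knd_tm :: "knd \<Rightarrow> trm \<Rightarrow> name \<Rightarrow> knd" ("_[_'/_]\<^sub>k" [1000, 0, 0] 1000) where
  "\<kappa>[s/x]\<^sub>k \<equiv> sub_knd \<kappa> (Var(x := s)) TVar"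
abbreviation trm_ty :: "trm \<Rightarrow> ty \<Rightarrow> name \<Rightarrow> trm" ("_[_'/_]\<^sub>E" [1000, 0, 0] 1000) where
  "t[S/X]\<^sub>E \<equiv> sub_trm t Var (TVar(X := S))"
abbreviation typ_ty :: "ty \<Rightarrow> ty \<Rightarrow> name \<Rightarrow> ty" ("_[_'/_]\<^sub>T" [1000, 0, 0] 1000) where
  "T[S/X]\<^sub>T \<equiv> sub_typ T Var (TVar(X := S))"
abbreviation knd_ty :: "knd \<Rightarrow> ty \<Rightarrow> name \<Rightarrow> knd" ("_[_'/_]\<^sub>K" [1000, 0, 0] 1000) where
  "\<kappa>[S/X]\<^sub>K \<equiv> sub_knd \<kappa> Var (TVar(X := S))"


section \<open>Conversion of types and kinds\<close>

text \<open>Terms inside types are compared only through their erasures.\<close>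

inductive typ_conv :: "ty \<Rightarrow> ty \<Rightarrow> bool" (infix "\<cong>\<^sub>t" 50)
  and knd_conv :: "knd \<Rightarrow> knd \<Rightarrow> bool" (infix "\<cong>\<^sub>k" 50) where
  tc_refl: "T \<cong>\<^sub>t T"
| tc_sym: "T \<cong>\<^sub>t T' \<Longrightarrow> T' \<cong>\<^sub>t T"
| tc_trans: "T \<cong>\<^sub>t T' \<Longrightarrow> T' \<cong>\<^sub>t T'' \<Longrightarrow> T \<cong>\<^sub>t T''"
| tc_Pi: "T \<cong>\<^sub>t S \<Longrightarrow> T' \<cong>\<^sub>t S' \<Longrightarrow> Pi x T T' \<cong>\<^sub>t Pi x S S'"
| tc_All: "T \<cong>\<^sub>t S \<Longrightarrow> T' \<cong>\<^sub>t S' \<Longrightarrow> All x T T' \<cong>\<^sub>t All x S S'"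
| tc_TAll: "\<kappa> \<cong>\<^sub>k \<kappa>' \<Longrightarrow> T \<cong>\<^sub>t S \<Longrightarrow> TAll X \<kappa> T \<cong>\<^sub>t TAll X \<kappa>' S"
| tc_Iota: "T \<cong>\<^sub>t S \<Longrightarrow> T' \<cong>\<^sub>t S' \<Longrightarrow> Iota x T T' \<cong>\<^sub>t Iota x S S'"
| tc_Equal: "\<^bold>|t\<^bold>| =\<^sub>\<alpha>\<^sub>\<beta>\<^sub>\<eta> \<^bold>|s\<^bold>| \<Longrightarrow> \<^bold>|t'\<^bold>| =\<^sub>\<alpha>\<^sub>\<beta>\<^sub>\<eta> \<^bold>|s'\<^bold>| \<Longrightarrow> Equal t t' \<cong>\<^sub>t Equal s s'"
| tc_TyLam: "T \<cong>\<^sub>t S \<Longrightarrow> T' \<cong>\<^sub>t S' \<Longrightarrow> TyLam x T T' \<cong>\<^sub>t TyLam x S S'"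
| tc_TyApp: "T \<cong>\<^sub>t S \<Longrightarrow> \<^bold>|t\<^bold>| =\<^sub>\<alpha>\<^sub>\<beta>\<^sub>\<eta> \<^bold>|s\<^bold>| \<Longrightarrow> TyApp T t \<cong>\<^sub>t TyApp S s"
| tc_TyTLam: "\<kappa> \<cong>\<^sub>k \<kappa>' \<Longrightarrow> T \<cong>\<^sub>t S \<Longrightarrow> TyTLam X \<kappa> T \<cong>\<^sub>t TyTLam X \<kappa>' S"
| tc_TyTApp: "T \<cong>\<^sub>t S \<Longrightarrow> T' \<cong>\<^sub>t S' \<Longrightarrow> TyTApp T T' \<cong>\<^sub>t TyTApp S S'"
| tc_beta: "TyApp (TyLam x T T') t \<cong>\<^sub>t T'[t/x]\<^sub>t"
| tc_Tbeta: "TyTApp (TyTLam X \<kappa> T) S \<cong>\<^sub>t T[S/X]\<^sub>T"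
| tc_Pi_alpha: "TmV y \<notin> fv_typ T' - {TmV x} \<Longrightarrow> Pi x T T' \<cong>\<^sub>t Pi y T (T'[Var y/x]\<^sub>t)"
| tc_All_alpha: "TmV y \<notin> fv_typ T' - {TmV x} \<Longrightarrow> All x T T' \<cong>\<^sub>t All y T (T'[Var y/x]\<^sub>t)"
| tc_TAll_alpha: "TyV Y \<notin> fv_typ T - {TyV X} \<Longrightarrow> TAll X \<kappa> T \<cong>\<^sub>t TAll Y \<kappa> (T[TVar Y/X]\<^sub>T)"
| tc_Iota_alpha: "TmV y \<notin> fv_typ T' - {TmV x} \<Longrightarrow> Iota x T T' \<cong>\<^sub>t Iota y T (T'[Var y/x]\<^sub>t)"
| tc_TyLam_alpha: "TmV y \<notin> fv_typ T' - {TmV x} \<Longrightarrow> TyLam x T T' \<cong>\<^sub>t TyLam y T (T'[Var y/x]\<^sub>t)"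
| tc_TyTLam_alpha: "TyV Y \<notin> fv_typ T - {TyV X} \<Longrightarrow> TyTLam X \<kappa> T \<cong>\<^sub>t TyTLam Y \<kappa> (T[TVar Y/X]\<^sub>T)"
| kc_refl: "\<kappa> \<cong>\<^sub>k \<kappa>"
| kc_sym: "\<kappa> \<cong>\<^sub>k \<kappa>' \<Longrightarrow> \<kappa>' \<cong>\<^sub>k \<kappa>"
| kc_trans: "\<kappa> \<cong>\<^sub>k \<kappa>' \<Longrightarrow> \<kappa>' \<cong>\<^sub>k \<kappa>'' \<Longrightarrow> \<kappa> \<cong>\<^sub>k \<kappa>''"
| kc_KPi: "T \<cong>\<^sub>t S \<Longrightarrow> \<kappa> \<cong>\<^sub>k \<kappa>' \<Longrightarrow> KPi x T \<kappa> \<cong>\<^sub>k KPi x S \<kappa>'"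
| kc_KTPi: "\<kappa>\<^sub>1 \<cong>\<^sub>k \<kappa>\<^sub>1' \<Longrightarrow> \<kappa>\<^sub>2 \<cong>\<^sub>k \<kappa>\<^sub>2' \<Longrightarrow> KTPi X \<kappa>\<^sub>1 \<kappa>\<^sub>2 \<cong>\<^sub>k KTPi X \<kappa>\<^sub>1' \<kappa>\<^sub>2'"
| kc_KPi_alpha: "TmV y \<notin> fv_knd \<kappa> - {TmV x} \<Longrightarrow> KPi x T \<kappa> \<cong>\<^sub>k KPi y T (\<kappa>[Var y/x]\<^sub>k)"
| kc_KTPi_alpha: "TyV Y \<notin> fv_knd \<kappa>\<^sub>2 - {TyV X} \<Longrightarrow> KTPi X \<kappa>\<^sub>1 \<kappa>\<^sub>2 \<cong>\<^sub>k KTPi Y \<kappa>\<^sub>1 (\<kappa>\<^sub>2[TVar Y/X]\<^sub>K)"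


section \<open>Kinding and typing\<close>

datatype decl = TmD name ty | TyD name knd

primrec decl_var :: "decl \<Rightarrow> var" where
  "decl_var (TmD x T) = TmV x"
| "decl_var (TyD X \<kappa>) = TyV X"

definition dom_ctx :: "decl list \<Rightarrow> var set" where
  "dom_ctx \<Gamma> = decl_var ` set \<Gamma>"

text \<open>
  Contexts declare each variable at most once. Since syntax is named, every rule that goes under a
  binder replaces the bound variable by a fresh \<open>y\<close> (or \<open>Y\<close>), so that shadowing is harmless; in
  the introduction rules the binder \<open>x\<close> of the term and \<open>z\<close> of its type may differ.

  In \<open>ty_BetaAt\<close> the term \<open>s\<close> that the proof erases to need only be well scoped, not typed.

  In \<open>ty_Rho\<close> the template \<open>T\<close> marks with \<open>x\<close> the occurrences to be rewritten. Its instances need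
  only be convertible to the well-kinded types \<open>S\<close> and \<open>S'\<close>: rewriting acts on erasures, so
  e.g. a \<open>xs\<close> may be rewritten when \<open>t\<^sub>1\<close> is \<open>xs\<^bold>.\<^bold>1\<^bold>.\<^bold>1\<close>, which has another type.
\<close>

inductive wf_ctx :: "decl list \<Rightarrow> bool" ("\<turnstile> _ ctx" [50] 50)
  and wf_knd :: "decl list \<Rightarrow> knd \<Rightarrow> bool" ("_ \<turnstile> _ kind" [50, 50] 50)
  and kinding :: "decl list \<Rightarrow> ty \<Rightarrow> knd \<Rightarrow> bool" ("_ \<turnstile> _ \<^bold>:\<^sub>k _" [50, 10, 10] 50)
  and typing :: "decl list \<Rightarrow> trm \<Rightarrow> ty \<Rightarrow> bool" ("_ \<turnstile> _ \<^bold>:\<^sub>t _" [50, 10, 10] 50) where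
  ctx_Nil: "\<turnstile> [] ctx"
| ctx_TmD: "\<Gamma> \<turnstile> T \<^bold>:\<^sub>k Star \<Longrightarrow> TmV x \<notin> dom_ctx \<Gamma> \<Longrightarrow> \<turnstile> TmD x T # \<Gamma> ctx"
| ctx_TyD: "\<Gamma> \<turnstile> \<kappa> kind \<Longrightarrow> TyV X \<notin> dom_ctx \<Gamma> \<Longrightarrow> \<turnstile> TyD X \<kappa> # \<Gamma> ctx"

| wk_Star: "\<turnstile> \<Gamma> ctx \<Longrightarrow> \<Gamma> \<turnstile> Star kind"
| wk_KPi: "TmD y T # \<Gamma> \<turnstile> \<kappa>[Var y/x]\<^sub>k kind \<Longrightarrow> TmV y \<notin> fv_knd (KPi x T \<kappa>) \<Longrightarrow>
    \<Gamma> \<turnstile> KPi x T \<kappa> kind"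
| wk_KTPi: "TyD Y \<kappa> # \<Gamma> \<turnstile> \<kappa>'[TVar Y/X]\<^sub>K kind \<Longrightarrow> TyV Y \<notin> fv_knd (KTPi X \<kappa> \<kappa>') \<Longrightarrow>
    \<Gamma> \<turnstile> KTPi X \<kappa> \<kappa>' kind"

| ki_TVar: "\<turnstile> \<Gamma> ctx \<Longrightarrow> TyD X \<kappa> \<in> set \<Gamma> \<Longrightarrow> \<Gamma> \<turnstile> TVar X \<^bold>:\<^sub>k \<kappa>"
| ki_Pi: "TmD y T # \<Gamma> \<turnstile> T'[Var y/x]\<^sub>t \<^bold>:\<^sub>k Star \<Longrightarrow> TmV y \<notin> fv_typ (Pi x T T') \<Longrightarrow>
    \<Gamma> \<turnstile> Pi x T T' \<^bold>:\<^sub>k Star"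
| ki_All: "TmD y T # \<Gamma> \<turnstile> T'[Var y/x]\<^sub>t \<^bold>:\<^sub>k Star \<Longrightarrow> TmV y \<notin> fv_typ (All x T T') \<Longrightarrow>
    \<Gamma> \<turnstile> All x T T' \<^bold>:\<^sub>k Star"
| ki_TAll: "TyD Y \<kappa> # \<Gamma> \<turnstile> T[TVar Y/X]\<^sub>T \<^bold>:\<^sub>k Star \<Longrightarrow> TyV Y \<notin> fv_typ (TAll X \<kappa> T) \<Longrightarrow>
    \<Gamma> \<turnstile> TAll X \<kappa> T \<^bold>:\<^sub>k Star"
| ki_Iota: "TmD y T # \<Gamma> \<turnstile> T'[Var y/x]\<^sub>t \<^bold>:\<^sub>k Star \<Longrightarrow> TmV y \<notin> fv_typ (Iota x T T') \<Longrightarrow>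
    \<Gamma> \<turnstile> Iota x T T' \<^bold>:\<^sub>k Star"
| ki_Equal: "\<Gamma> \<turnstile> t \<^bold>:\<^sub>t T \<Longrightarrow> \<Gamma> \<turnstile> t' \<^bold>:\<^sub>t T' \<Longrightarrow> \<Gamma> \<turnstile> Equal t t' \<^bold>:\<^sub>k Star"
| ki_TyLam: "TmD y T # \<Gamma> \<turnstile> T'[Var y/x]\<^sub>t \<^bold>:\<^sub>k \<kappa>[Var y/z]\<^sub>k \<Longrightarrow>
    TmV y \<notin> fv_typ (TyLam x T T') \<Longrightarrow> TmV y \<notin> fv_knd (KPi z T \<kappa>) \<Longrightarrow>
    \<Gamma> \<turnstile> TyLam x T T' \<^bold>:\<^sub>k KPi z T \<kappa>"
| ki_TyApp: "\<Gamma> \<turnstile> T \<^bold>:\<^sub>k KPi x S \<kappa> \<Longrightarrow> \<Gamma> \<turnstile> t \<^bold>:\<^sub>t S \<Longrightarrow> \<Gamma> \<turnstile> TyApp T t \<^bold>:\<^sub>k \<kappa>[t/x]\<^sub>k"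
| ki_TyTLam: "TyD Y \<kappa> # \<Gamma> \<turnstile> T[TVar Y/X]\<^sub>T \<^bold>:\<^sub>k \<kappa>'[TVar Y/Z]\<^sub>K \<Longrightarrow>
    TyV Y \<notin> fv_typ (TyTLam X \<kappa> T) \<Longrightarrow> TyV Y \<notin> fv_knd (KTPi Z \<kappa> \<kappa>') \<Longrightarrow>
    \<Gamma> \<turnstile> TyTLam X \<kappa> T \<^bold>:\<^sub>k KTPi Z \<kappa> \<kappa>'"
| ki_TyTApp: "\<Gamma> \<turnstile> T \<^bold>:\<^sub>k KTPi X \<kappa> \<kappa>' \<Longrightarrow> \<Gamma> \<turnstile> S \<^bold>:\<^sub>k \<kappa> \<Longrightarrow> \<Gamma> \<turnstile> TyTApp T S \<^bold>:\<^sub>k \<kappa>'[S/X]\<^sub>K"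
| ki_conv: "\<Gamma> \<turnstile> T \<^bold>:\<^sub>k \<kappa> \<Longrightarrow> \<kappa> \<cong>\<^sub>k \<kappa>' \<Longrightarrow> \<Gamma> \<turnstile> \<kappa>' kind \<Longrightarrow> \<Gamma> \<turnstile> T \<^bold>:\<^sub>k \<kappa>'"

| ty_Var: "\<turnstile> \<Gamma> ctx \<Longrightarrow> TmD x T \<in> set \<Gamma> \<Longrightarrow> \<Gamma> \<turnstile> Var x \<^bold>:\<^sub>t T"
| ty_Lam: "TmD y T # \<Gamma> \<turnstile> t[Var y/x]\<^sub>e \<^bold>:\<^sub>t T'[Var y/z]\<^sub>t \<Longrightarrow>
    TmV y \<notin> fv_trm (Lam x t) \<Longrightarrow> TmV y \<notin> fv_typ (Pi z T T') \<Longrightarrow>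
    \<Gamma> \<turnstile> Lam x t \<^bold>:\<^sub>t Pi z T T'"
| ty_App: "\<Gamma> \<turnstile> t \<^bold>:\<^sub>t Pi x T T' \<Longrightarrow> \<Gamma> \<turnstile> t' \<^bold>:\<^sub>t T \<Longrightarrow> \<Gamma> \<turnstile> App t t' \<^bold>:\<^sub>t T'[t'/x]\<^sub>t"
| ty_ILam: "TmD y T # \<Gamma> \<turnstile> t[Var y/x]\<^sub>e \<^bold>:\<^sub>t T'[Var y/z]\<^sub>t \<Longrightarrow>
    TmV y \<notin> fv_trm (ILam x t) \<Longrightarrow> TmV y \<notin> fv_typ (All z T T') \<Longrightarrow> x \<notin> fv_lam \<^bold>|t\<^bold>| \<Longrightarrow>
    \<Gamma> \<turnstile> ILam x t \<^bold>:\<^sub>t All z T T'"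
| ty_IApp: "\<Gamma> \<turnstile> t \<^bold>:\<^sub>t All x T T' \<Longrightarrow> \<Gamma> \<turnstile> t' \<^bold>:\<^sub>t T \<Longrightarrow> \<Gamma> \<turnstile> IApp t t' \<^bold>:\<^sub>t T'[t'/x]\<^sub>t"
| ty_TLam: "TyD Y \<kappa> # \<Gamma> \<turnstile> t[TVar Y/X]\<^sub>E \<^bold>:\<^sub>t T[TVar Y/Z]\<^sub>T \<Longrightarrow>
    TyV Y \<notin> fv_trm (TLam X t) \<Longrightarrow> TyV Y \<notin> fv_typ (TAll Z \<kappa> T) \<Longrightarrow>
    \<Gamma> \<turnstile> TLam X t \<^bold>:\<^sub>t TAll Z \<kappa> T"
| ty_TApp: "\<Gamma> \<turnstile> t \<^bold>:\<^sub>t TAll X \<kappa> T \<Longrightarrow> \<Gamma> \<turnstile> S \<^bold>:\<^sub>k \<kappa> \<Longrightarrow> \<Gamma> \<turnstile> TApp t S \<^bold>:\<^sub>t T[S/X]\<^sub>T"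
| ty_Pair: "\<Gamma> \<turnstile> t \<^bold>:\<^sub>t T \<Longrightarrow> \<Gamma> \<turnstile> t' \<^bold>:\<^sub>t T'[t/x]\<^sub>t \<Longrightarrow> \<^bold>|t\<^bold>| =\<^sub>\<alpha>\<^sub>\<beta>\<^sub>\<eta> \<^bold>|t'\<^bold>| \<Longrightarrow>
    \<Gamma> \<turnstile> Iota x T T' \<^bold>:\<^sub>k Star \<Longrightarrow> \<Gamma> \<turnstile> Pair t t' \<^bold>:\<^sub>t Iota x T T'"
| ty_Proj1: "\<Gamma> \<turnstile> t \<^bold>:\<^sub>t Iota x T T' \<Longrightarrow> \<Gamma> \<turnstile> Proj1 t \<^bold>:\<^sub>t T"
| ty_Proj2: "\<Gamma> \<turnstile> t \<^bold>:\<^sub>t Iota x T T' \<Longrightarrow> \<Gamma> \<turnstile> Proj2 t \<^bold>:\<^sub>t T'[Proj1 t/x]\<^sub>t"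
| ty_Beta: "\<Gamma> \<turnstile> t \<^bold>:\<^sub>t T \<Longrightarrow> \<Gamma> \<turnstile> Beta \<^bold>:\<^sub>t Equal t t"
| ty_BetaAt: "\<Gamma> \<turnstile> t \<^bold>:\<^sub>t T \<Longrightarrow> fv_trm s \<subseteq> dom_ctx \<Gamma> \<Longrightarrow> well_erased s \<Longrightarrow>
    \<Gamma> \<turnstile> BetaAt s \<^bold>:\<^sub>t Equal t t"
| ty_Rho: "\<Gamma> \<turnstile> q \<^bold>:\<^sub>t Equal t\<^sub>1 t\<^sub>2 \<Longrightarrow> \<Gamma> \<turnstile> t \<^bold>:\<^sub>t S \<Longrightarrow> S \<cong>\<^sub>t T[t\<^sub>2/x]\<^sub>t \<Longrightarrow>
    T[t\<^sub>1/x]\<^sub>t \<cong>\<^sub>t S' \<Longrightarrow> \<Gamma> \<turnstile> S' \<^bold>:\<^sub>k Star \<Longrightarrow> \<Gamma> \<turnstile> Rho q t \<^bold>:\<^sub>t S'"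
| ty_Sym: "\<Gamma> \<turnstile> q \<^bold>:\<^sub>t Equal t\<^sub>1 t\<^sub>2 \<Longrightarrow> \<Gamma> \<turnstile> Sym q \<^bold>:\<^sub>t Equal t\<^sub>2 t\<^sub>1"
| ty_conv: "\<Gamma> \<turnstile> t \<^bold>:\<^sub>t T \<Longrightarrow> T \<cong>\<^sub>t T' \<Longrightarrow> \<Gamma> \<turnstile> T' \<^bold>:\<^sub>k Star \<Longrightarrow> \<Gamma> \<turnstile> t \<^bold>:\<^sub>t T'"


section \<open>Natural numbers\<close>

text \<open>
  Defined constants of the object language are definitions of closed syntax, hence unfolded
  wherever they are used. Naturals are given by the same construction as lists.
\<close>

definition NatC :: ty where
  "NatC = (\<^bold>\<forall>\<^sub>T''X''\<^bold>:\<^bold>\<star>. TVar ''X'' \<^bold>\<rightarrow> (TVar ''X'' \<^bold>\<rightarrow> TVar ''X'') \<^bold>\<rightarrow> TVar ''X'')"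

definition zeroC :: trm where
  "zeroC = (\<^bold>\<Lambda>\<^sub>T''X''. \<^bold>\<lambda>''cZ''. \<^bold>\<lambda>''cS''. Var ''cZ'')"

definition sucC :: trm where
  "sucC = (\<^bold>\<lambda>''n''. \<^bold>\<Lambda>\<^sub>T''X''. \<^bold>\<lambda>''cZ''. \<^bold>\<lambda>''cS''.
     Var ''cS'' \<^bold>@ (Var ''n'' \<^bold>\<cdot> TVar ''X'' \<^bold>@ Var ''cZ'' \<^bold>@ Var ''cS''))"

definition NatP :: ty where
  "NatP = (\<^bold>\<lambda>\<^sub>t''nC''\<^bold>:NatC.
     \<^bold>\<forall>\<^sub>T''X''\<^bold>:\<^bold>\<star>. \<^bold>\<forall>\<^sub>T''P''\<^bold>:(TVar ''X'' \<^bold>\<rightarrow>\<^sub>k \<^bold>\<star>).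
     \<^bold>\<forall>''cZ''\<^bold>:TVar ''X''. \<^bold>\<forall>''cS''\<^bold>:(TVar ''X'' \<^bold>\<rightarrow> TVar ''X'').
     TVar ''P'' \<^bold>@\<^sub>t Var ''cZ'' \<^bold>\<rightarrow>
     (\<^bold>\<forall>''n''\<^bold>:TVar ''X''. TVar ''P'' \<^bold>@\<^sub>t Var ''n'' \<^bold>\<rightarrow> TVar ''P'' \<^bold>@\<^sub>t (Var ''cS'' \<^bold>@ Var ''n'')) \<^bold>\<rightarrow>
     TVar ''P'' \<^bold>@\<^sub>t (Var ''nC'' \<^bold>\<cdot> TVar ''X'' \<^bold>@ Var ''cZ'' \<^bold>@ Var ''cS''))"

definition NatR :: ty where
  "NatR = (\<^bold>\<lambda>\<^sub>t''nC''\<^bold>:NatC. (Var ''nC'' \<^bold>\<cdot> NatC \<^bold>@ zeroC \<^bold>@ sucC) \<^bold>\<simeq> Var ''nC'')"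

definition NatT :: ty where
  "NatT = (\<^bold>\<iota>''n''\<^bold>:(\<^bold>\<iota>''nC''\<^bold>:NatC. NatP \<^bold>@\<^sub>t Var ''nC''). NatR \<^bold>@\<^sub>t (Var ''n'')\<^bold>.\<^bold>1)"

definition mkNat :: trm where
  "mkNat = (\<^bold>\<lambda>''n''. \<^bold>\<Lambda>''q''. \<^bold>[Var ''n'', \<^bold>\<rho> Var ''q'' \<^bold>\<midarrow> \<^bold>\<beta>\<^bold>{Var ''n''\<^bold>}\<^bold>])"

definition zeroP :: trm where
  "zeroP = (\<^bold>\<Lambda>\<^sub>T''X''. \<^bold>\<Lambda>\<^sub>T''P''. \<^bold>\<Lambda>''cZ''. \<^bold>\<Lambda>''cS''. \<^bold>\<lambda>''pZ''. \<^bold>\<lambda>''pS''. Var ''pZ'')"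

definition zeroN :: trm where
  "zeroN = mkNat \<^bold>@ \<^bold>[zeroC, zeroP\<^bold>] \<^bold>- \<^bold>\<beta>"

definition sucP :: trm where
  "sucP = (\<^bold>\<lambda>''n''. \<^bold>\<Lambda>\<^sub>T''X''. \<^bold>\<Lambda>\<^sub>T''P''. \<^bold>\<Lambda>''cZ''. \<^bold>\<Lambda>''cS''. \<^bold>\<lambda>''pZ''. \<^bold>\<lambda>''pS''.
     Var ''pS'' \<^bold>- ((Var ''n'')\<^bold>.\<^bold>1\<^bold>.\<^bold>1 \<^bold>\<cdot> TVar ''X'' \<^bold>@ Var ''cZ'' \<^bold>@ Var ''cS'')
       \<^bold>@ ((Var ''n'')\<^bold>.\<^bold>1\<^bold>.\<^bold>2 \<^bold>\<cdot> TVar ''X'' \<^bold>\<cdot> TVar ''P'' \<^bold>- Var ''cZ'' \<^bold>- Var ''cS''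
            \<^bold>@ Var ''pZ'' \<^bold>@ Var ''pS''))"

definition sucN :: trm where
  "sucN = (\<^bold>\<lambda>''n''. mkNat \<^bold>@ \<^bold>[sucC \<^bold>@ (Var ''n'')\<^bold>.\<^bold>1\<^bold>.\<^bold>1, sucP \<^bold>@ Var ''n''\<^bold>]
     \<^bold>- (\<^bold>\<rho> (Var ''n'')\<^bold>.\<^bold>2 \<^bold>\<midarrow> \<^bold>\<beta>))"

definition addN :: trm where
  "addN = (\<^bold>\<lambda>''n''. \<^bold>\<lambda>''m''. (Var ''n'')\<^bold>.\<^bold>1\<^bold>.\<^bold>1 \<^bold>\<cdot> NatT \<^bold>@ Var ''m'' \<^bold>@ sucN)"


section \<open>Lists\<close>

definition ListC :: ty where
  "ListC = (\<^bold>\<lambda>\<^sub>T''A''\<^bold>:\<^bold>\<star>.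
     \<^bold>\<forall>\<^sub>T''X''\<^bold>:\<^bold>\<star>. TVar ''X'' \<^bold>\<rightarrow> (TVar ''A'' \<^bold>\<rightarrow> TVar ''X'' \<^bold>\<rightarrow> TVar ''X'') \<^bold>\<rightarrow> TVar ''X'')"

definition nilCL :: trm where
  "nilCL = (\<^bold>\<Lambda>\<^sub>T''A''. \<^bold>\<Lambda>\<^sub>T''X''. \<^bold>\<lambda>''cN''. \<^bold>\<lambda>''cC''. Var ''cN'')"

definition consCL :: trm where
  "consCL = (\<^bold>\<Lambda>\<^sub>T''A''. \<^bold>\<lambda>''x''. \<^bold>\<lambda>''xs''. \<^bold>\<Lambda>\<^sub>T''X''. \<^bold>\<lambda>''cN''. \<^bold>\<lambda>''cC''.
     Var ''cC'' \<^bold>@ Var ''x'' \<^bold>@ (Var ''xs'' \<^bold>\<cdot> TVar ''X'' \<^bold>@ Var ''cN'' \<^bold>@ Var ''cC''))"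

definition ListP :: ty where
  "ListP = (\<^bold>\<lambda>\<^sub>T''A''\<^bold>:\<^bold>\<star>. \<^bold>\<lambda>\<^sub>t''xsC''\<^bold>:(ListC \<^bold>\<cdot>\<^sub>T TVar ''A'').
     \<^bold>\<forall>\<^sub>T''X''\<^bold>:\<^bold>\<star>. \<^bold>\<forall>\<^sub>T''P''\<^bold>:(TVar ''X'' \<^bold>\<rightarrow>\<^sub>k \<^bold>\<star>).
     \<^bold>\<forall>''cN''\<^bold>:TVar ''X''. \<^bold>\<forall>''cC''\<^bold>:(TVar ''A'' \<^bold>\<rightarrow> TVar ''X'' \<^bold>\<rightarrow> TVar ''X'').
     TVar ''P'' \<^bold>@\<^sub>t Var ''cN'' \<^bold>\<rightarrow>
     (\<^bold>\<forall>''xs''\<^bold>:TVar ''X''. \<^bold>\<Pi>''x''\<^bold>:TVar ''A''. TVar ''P'' \<^bold>@\<^sub>t Var ''xs'' \<^bold>\<rightarrow>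
        TVar ''P'' \<^bold>@\<^sub>t (Var ''cC'' \<^bold>@ Var ''x'' \<^bold>@ Var ''xs'')) \<^bold>\<rightarrow>
     TVar ''P'' \<^bold>@\<^sub>t (Var ''xsC'' \<^bold>\<cdot> TVar ''X'' \<^bold>@ Var ''cN'' \<^bold>@ Var ''cC''))"

definition ListR :: ty where
  "ListR = (\<^bold>\<lambda>\<^sub>T''A''\<^bold>:\<^bold>\<star>. \<^bold>\<lambda>\<^sub>t''xsC''\<^bold>:(ListC \<^bold>\<cdot>\<^sub>T TVar ''A'').
     (Var ''xsC'' \<^bold>\<cdot> (ListC \<^bold>\<cdot>\<^sub>T TVar ''A'') \<^bold>@ (nilCL \<^bold>\<cdot> TVar ''A'') \<^bold>@ (consCL \<^bold>\<cdot> TVar ''A''))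
       \<^bold>\<simeq> Var ''xsC'')"

definition ListT :: ty where
  "ListT = (\<^bold>\<lambda>\<^sub>T''A''\<^bold>:\<^bold>\<star>.
     \<^bold>\<iota>''xs''\<^bold>:(\<^bold>\<iota>''xsC''\<^bold>:(ListC \<^bold>\<cdot>\<^sub>T TVar ''A''). ListP \<^bold>\<cdot>\<^sub>T TVar ''A'' \<^bold>@\<^sub>t Var ''xsC'').
       ListR \<^bold>\<cdot>\<^sub>T TVar ''A'' \<^bold>@\<^sub>t (Var ''xs'')\<^bold>.\<^bold>1)"

definition mkList :: trm where
  "mkList = (\<^bold>\<Lambda>\<^sub>T''A''. \<^bold>\<lambda>''xs''. \<^bold>\<Lambda>''q''. \<^bold>[Var ''xs'', \<^bold>\<rho> Var ''q'' \<^bold>\<midarrow> \<^bold>\<beta>\<^bold>{Var ''xs''\<^bold>}\<^bold>])"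

definition nilPL :: trm where
  "nilPL = (\<^bold>\<Lambda>\<^sub>T''A''. \<^bold>\<Lambda>\<^sub>T''X''. \<^bold>\<Lambda>\<^sub>T''P''. \<^bold>\<Lambda>''cN''. \<^bold>\<Lambda>''cC''. \<^bold>\<lambda>''pN''. \<^bold>\<lambda>''pC''. Var ''pN'')"

definition nilL :: trm where
  "nilL = (\<^bold>\<Lambda>\<^sub>T''A''. mkList \<^bold>\<cdot> TVar ''A''
     \<^bold>@ \<^bold>[nilCL \<^bold>\<cdot> TVar ''A'', nilPL \<^bold>\<cdot> TVar ''A''\<^bold>] \<^bold>- \<^bold>\<beta>)"

definition consPL :: trm where
  "consPL = (\<^bold>\<Lambda>\<^sub>T''A''. \<^bold>\<lambda>''x''. \<^bold>\<lambda>''xs''.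
     \<^bold>\<Lambda>\<^sub>T''X''. \<^bold>\<Lambda>\<^sub>T''P''. \<^bold>\<Lambda>''cN''. \<^bold>\<Lambda>''cC''. \<^bold>\<lambda>''pN''. \<^bold>\<lambda>''pC''.
     Var ''pC'' \<^bold>- ((Var ''xs'')\<^bold>.\<^bold>1\<^bold>.\<^bold>1 \<^bold>\<cdot> TVar ''X'' \<^bold>@ Var ''cN'' \<^bold>@ Var ''cC'') \<^bold>@ Var ''x''
       \<^bold>@ ((Var ''xs'')\<^bold>.\<^bold>1\<^bold>.\<^bold>2 \<^bold>\<cdot> TVar ''X'' \<^bold>\<cdot> TVar ''P'' \<^bold>- Var ''cN'' \<^bold>- Var ''cC''
            \<^bold>@ Var ''pN'' \<^bold>@ Var ''pC''))"

definition consL :: trm where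
  "consL = (\<^bold>\<Lambda>\<^sub>T''A''. \<^bold>\<lambda>''x''. \<^bold>\<lambda>''xs''. mkList \<^bold>\<cdot> TVar ''A''
     \<^bold>@ \<^bold>[consCL \<^bold>\<cdot> TVar ''A'' \<^bold>@ Var ''x'' \<^bold>@ (Var ''xs'')\<^bold>.\<^bold>1\<^bold>.\<^bold>1,
         consPL \<^bold>\<cdot> TVar ''A'' \<^bold>@ Var ''x'' \<^bold>@ Var ''xs''\<^bold>]
     \<^bold>- (\<^bold>\<rho> (Var ''xs'')\<^bold>.\<^bold>2 \<^bold>\<midarrow> \<^bold>\<beta>))"

definition elimList :: trm where
  "elimList = (\<^bold>\<Lambda>\<^sub>T''A''. \<^bold>\<lambda>''xs''. \<^bold>\<Lambda>\<^sub>T''P''.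
     \<^bold>\<rho> (\<^bold>\<sigma> (Var ''xs'')\<^bold>.\<^bold>2) \<^bold>\<midarrow>
       ((Var ''xs'')\<^bold>.\<^bold>1\<^bold>.\<^bold>2 \<^bold>\<cdot> (ListT \<^bold>\<cdot>\<^sub>T TVar ''A'') \<^bold>\<cdot> TVar ''P''
          \<^bold>- (nilL \<^bold>\<cdot> TVar ''A'') \<^bold>- (consL \<^bold>\<cdot> TVar ''A'')))"

definition lengthL :: trm where
  "lengthL = (\<^bold>\<Lambda>\<^sub>T''A''. \<^bold>\<lambda>''xs''.
     (Var ''xs'')\<^bold>.\<^bold>1\<^bold>.\<^bold>1 \<^bold>\<cdot> NatT \<^bold>@ zeroN \<^bold>@ (\<^bold>\<lambda>''x''. sucN))"


section \<open>Vectors\<close>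

definition VecC :: ty where
  "VecC = (\<^bold>\<lambda>\<^sub>T''A''\<^bold>:\<^bold>\<star>. \<^bold>\<lambda>\<^sub>t''n''\<^bold>:NatT.
     \<^bold>\<forall>\<^sub>T''X''\<^bold>:(NatT \<^bold>\<rightarrow>\<^sub>k \<^bold>\<star>).
     TVar ''X'' \<^bold>@\<^sub>t zeroN \<^bold>\<rightarrow>
     (\<^bold>\<forall>''n''\<^bold>:NatT. TVar ''A'' \<^bold>\<rightarrow> TVar ''X'' \<^bold>@\<^sub>t Var ''n'' \<^bold>\<rightarrow> TVar ''X'' \<^bold>@\<^sub>t (sucN \<^bold>@ Var ''n'')) \<^bold>\<rightarrow>
     TVar ''X'' \<^bold>@\<^sub>t Var ''n'')"

definition nilCV :: trm where
  "nilCV = (\<^bold>\<Lambda>\<^sub>T''A''. \<^bold>\<Lambda>\<^sub>T''X''. \<^bold>\<lambda>''cN''. \<^bold>\<lambda>''cC''. Var ''cN'')"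

definition consCV :: trm where
  "consCV = (\<^bold>\<Lambda>\<^sub>T''A''. \<^bold>\<Lambda>''n''. \<^bold>\<lambda>''x''. \<^bold>\<lambda>''xs''. \<^bold>\<Lambda>\<^sub>T''X''. \<^bold>\<lambda>''cN''. \<^bold>\<lambda>''cC''.
     Var ''cC'' \<^bold>- Var ''n'' \<^bold>@ Var ''x'' \<^bold>@ (Var ''xs'' \<^bold>\<cdot> TVar ''X'' \<^bold>@ Var ''cN'' \<^bold>@ Var ''cC''))"

definition VecP :: ty where
  "VecP = (\<^bold>\<lambda>\<^sub>T''A''\<^bold>:\<^bold>\<star>. \<^bold>\<lambda>\<^sub>t''n''\<^bold>:NatT. \<^bold>\<lambda>\<^sub>t''xsC''\<^bold>:(VecC \<^bold>\<cdot>\<^sub>T TVar ''A'' \<^bold>@\<^sub>t Var ''n'').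
     \<^bold>\<forall>\<^sub>T''X''\<^bold>:(NatT \<^bold>\<rightarrow>\<^sub>k \<^bold>\<star>). \<^bold>\<forall>\<^sub>T''P''\<^bold>:(\<^bold>\<Pi>\<^sub>t''n''\<^bold>:NatT. TVar ''X'' \<^bold>@\<^sub>t Var ''n'' \<^bold>\<rightarrow>\<^sub>k \<^bold>\<star>).
     \<^bold>\<forall>''cN''\<^bold>:(TVar ''X'' \<^bold>@\<^sub>t zeroN).
     \<^bold>\<forall>''cC''\<^bold>:(\<^bold>\<forall>''n''\<^bold>:NatT. TVar ''A'' \<^bold>\<rightarrow> TVar ''X'' \<^bold>@\<^sub>t Var ''n'' \<^bold>\<rightarrow>
              TVar ''X'' \<^bold>@\<^sub>t (sucN \<^bold>@ Var ''n'')).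
     TVar ''P'' \<^bold>@\<^sub>t zeroN \<^bold>@\<^sub>t Var ''cN'' \<^bold>\<rightarrow>
     (\<^bold>\<forall>''n''\<^bold>:NatT. \<^bold>\<forall>''xs''\<^bold>:(TVar ''X'' \<^bold>@\<^sub>t Var ''n''). \<^bold>\<Pi>''x''\<^bold>:TVar ''A''.
        TVar ''P'' \<^bold>@\<^sub>t Var ''n'' \<^bold>@\<^sub>t Var ''xs'' \<^bold>\<rightarrow>
        TVar ''P'' \<^bold>@\<^sub>t (sucN \<^bold>@ Var ''n'') \<^bold>@\<^sub>t (Var ''cC'' \<^bold>- Var ''n'' \<^bold>@ Var ''x'' \<^bold>@ Var ''xs'')) \<^bold>\<rightarrow>
     TVar ''P'' \<^bold>@\<^sub>t Var ''n'' \<^bold>@\<^sub>t (Var ''xsC'' \<^bold>\<cdot> TVar ''X'' \<^bold>@ Var ''cN'' \<^bold>@ Var ''cC''))"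

definition VecR :: ty where
  "VecR = (\<^bold>\<lambda>\<^sub>T''A''\<^bold>:\<^bold>\<star>. \<^bold>\<lambda>\<^sub>t''n''\<^bold>:NatT. \<^bold>\<lambda>\<^sub>t''xsC''\<^bold>:(VecC \<^bold>\<cdot>\<^sub>T TVar ''A'' \<^bold>@\<^sub>t Var ''n'').
     (Var ''xsC'' \<^bold>\<cdot> (VecC \<^bold>\<cdot>\<^sub>T TVar ''A'') \<^bold>@ (nilCV \<^bold>\<cdot> TVar ''A'') \<^bold>@ (consCV \<^bold>\<cdot> TVar ''A''))
       \<^bold>\<simeq> Var ''xsC'')"

definition VecT :: ty where
  "VecT = (\<^bold>\<lambda>\<^sub>T''A''\<^bold>:\<^bold>\<star>. \<^bold>\<lambda>\<^sub>t''n''\<^bold>:NatT.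
     \<^bold>\<iota>''xs''\<^bold>:(\<^bold>\<iota>''xsC''\<^bold>:(VecC \<^bold>\<cdot>\<^sub>T TVar ''A'' \<^bold>@\<^sub>t Var ''n'').
              VecP \<^bold>\<cdot>\<^sub>T TVar ''A'' \<^bold>@\<^sub>t Var ''n'' \<^bold>@\<^sub>t Var ''xsC'').
       VecR \<^bold>\<cdot>\<^sub>T TVar ''A'' \<^bold>@\<^sub>t Var ''n'' \<^bold>@\<^sub>t (Var ''xs'')\<^bold>.\<^bold>1)"

definition mkVec :: trm where
  "mkVec = (\<^bold>\<Lambda>\<^sub>T''A''. \<^bold>\<Lambda>''n''. \<^bold>\<lambda>''xs''. \<^bold>\<Lambda>''q''.
     \<^bold>[Var ''xs'', \<^bold>\<rho> Var ''q'' \<^bold>\<midarrow> \<^bold>\<beta>\<^bold>{Var ''xs''\<^bold>}\<^bold>])"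


section \<open>Coercions and append by reuse\<close>

definition v2lC :: trm where
  "v2lC = (\<^bold>\<Lambda>\<^sub>T''A''. \<^bold>\<Lambda>''n''. \<^bold>\<lambda>''xs''. \<^bold>\<Lambda>\<^sub>T''X''. \<^bold>\<lambda>''cN''. \<^bold>\<lambda>''cC''.
     (Var ''xs'')\<^bold>.\<^bold>1\<^bold>.\<^bold>1 \<^bold>\<cdot> (\<^bold>\<lambda>\<^sub>t''_''\<^bold>:NatT. TVar ''X'') \<^bold>@ Var ''cN'' \<^bold>@ (\<^bold>\<Lambda>''_''. Var ''cC''))"

definition v2lP :: trm where
  "v2lP = (\<^bold>\<Lambda>\<^sub>T''A''. \<^bold>\<Lambda>''n''. \<^bold>\<lambda>''xs''.
     \<^bold>\<Lambda>\<^sub>T''X''. \<^bold>\<Lambda>\<^sub>T''P''. \<^bold>\<Lambda>''cN''. \<^bold>\<Lambda>''cC''. \<^bold>\<lambda>''pN''. \<^bold>\<lambda>''pC''.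
     (Var ''xs'')\<^bold>.\<^bold>1\<^bold>.\<^bold>2 \<^bold>\<cdot> (\<^bold>\<lambda>\<^sub>t''_''\<^bold>:NatT. TVar ''X'') \<^bold>\<cdot> (\<^bold>\<lambda>\<^sub>t''_''\<^bold>:NatT. TVar ''P'')
       \<^bold>- Var ''cN'' \<^bold>- (\<^bold>\<Lambda>''_''. Var ''cC'') \<^bold>@ Var ''pN'' \<^bold>@ (\<^bold>\<Lambda>''_''. Var ''pC''))"

definition v2lR :: trm where
  "v2lR = (\<^bold>\<Lambda>\<^sub>T''A''. \<^bold>\<Lambda>''n''. \<^bold>\<lambda>''xs''. (Var ''xs'')\<^bold>.\<^bold>2)"

definition v2l :: trm where
  "v2l = (\<^bold>\<Lambda>\<^sub>T''A''. \<^bold>\<Lambda>''n''. \<^bold>\<lambda>''xs''. mkList \<^bold>\<cdot> TVar ''A''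
     \<^bold>@ \<^bold>[v2lC \<^bold>\<cdot> TVar ''A'' \<^bold>- Var ''n'' \<^bold>@ Var ''xs'', v2lP \<^bold>\<cdot> TVar ''A'' \<^bold>- Var ''n'' \<^bold>@ Var ''xs''\<^bold>]
     \<^bold>- (v2lR \<^bold>\<cdot> TVar ''A'' \<^bold>- Var ''n'' \<^bold>@ Var ''xs''))"

definition l2vC :: trm where
  "l2vC = (\<^bold>\<Lambda>\<^sub>T''A''. \<^bold>\<lambda>''xs''. \<^bold>\<Lambda>\<^sub>T''X''. \<^bold>\<lambda>''cN''. \<^bold>\<lambda>''cC''.
     elimList \<^bold>\<cdot> TVar ''A'' \<^bold>@ Var ''xs''
       \<^bold>\<cdot> (\<^bold>\<lambda>\<^sub>t''xs''\<^bold>:(ListT \<^bold>\<cdot>\<^sub>T TVar ''A''). TVar ''X'' \<^bold>@\<^sub>t (lengthL \<^bold>\<cdot> TVar ''A'' \<^bold>@ Var ''xs''))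
       \<^bold>@ Var ''cN'' \<^bold>@ (\<^bold>\<Lambda>''xs''. Var ''cC'' \<^bold>- (lengthL \<^bold>\<cdot> TVar ''A'' \<^bold>@ Var ''xs'')))"

definition l2vP :: trm where
  "l2vP = (\<^bold>\<Lambda>\<^sub>T''A''. \<^bold>\<lambda>''xs''.
     \<^bold>\<Lambda>\<^sub>T''X''. \<^bold>\<Lambda>\<^sub>T''P''. \<^bold>\<Lambda>''cN''. \<^bold>\<Lambda>''cC''. \<^bold>\<lambda>''pN''. \<^bold>\<lambda>''pC''.
     elimList \<^bold>\<cdot> TVar ''A'' \<^bold>@ Var ''xs''
       \<^bold>\<cdot> (\<^bold>\<lambda>\<^sub>t''xs''\<^bold>:(ListT \<^bold>\<cdot>\<^sub>T TVar ''A'').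
            TVar ''P'' \<^bold>@\<^sub>t (lengthL \<^bold>\<cdot> TVar ''A'' \<^bold>@ Var ''xs'')
              \<^bold>@\<^sub>t (l2vC \<^bold>\<cdot> TVar ''A'' \<^bold>@ Var ''xs'' \<^bold>\<cdot> TVar ''X'' \<^bold>@ Var ''cN'' \<^bold>@ Var ''cC''))
       \<^bold>@ Var ''pN''
       \<^bold>@ (\<^bold>\<Lambda>''xs''. Var ''pC'' \<^bold>- (lengthL \<^bold>\<cdot> TVar ''A'' \<^bold>@ Var ''xs'')
            \<^bold>- (l2vC \<^bold>\<cdot> TVar ''A'' \<^bold>@ Var ''xs'' \<^bold>\<cdot> TVar ''X'' \<^bold>@ Var ''cN'' \<^bold>@ Var ''cC'')))"

definition l2vR :: trm where
  "l2vR = (\<^bold>\<Lambda>\<^sub>T''A''. \<^bold>\<lambda>''xs''. (Var ''xs'')\<^bold>.\<^bold>2)"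

definition l2v :: trm where
  "l2v = (\<^bold>\<Lambda>\<^sub>T''A''. \<^bold>\<lambda>''xs''.
     mkVec \<^bold>\<cdot> TVar ''A'' \<^bold>- (lengthL \<^bold>\<cdot> TVar ''A'' \<^bold>@ Var ''xs'')
       \<^bold>@ \<^bold>[l2vC \<^bold>\<cdot> TVar ''A'' \<^bold>@ Var ''xs'', l2vP \<^bold>\<cdot> TVar ''A'' \<^bold>@ Var ''xs''\<^bold>]
       \<^bold>- (l2vR \<^bold>\<cdot> TVar ''A'' \<^bold>@ Var ''xs''))"

definition appendL :: "trm \<Rightarrow> trm" where
  "appendL appendV = (\<^bold>\<Lambda>\<^sub>T''A''. \<^bold>\<lambda>''xs''. \<^bold>\<lambda>''ys''.
     v2l \<^bold>\<cdot> TVar ''A''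
       \<^bold>- (addN \<^bold>@ (lengthL \<^bold>\<cdot> TVar ''A'' \<^bold>@ Var ''xs'') \<^bold>@ (lengthL \<^bold>\<cdot> TVar ''A'' \<^bold>@ Var ''ys''))
       \<^bold>@ (appendV \<^bold>\<cdot> TVar ''A''
            \<^bold>- (lengthL \<^bold>\<cdot> TVar ''A'' \<^bold>@ Var ''xs'') \<^bold>@ (l2v \<^bold>\<cdot> TVar ''A'' \<^bold>@ Var ''xs'')
            \<^bold>- (lengthL \<^bold>\<cdot> TVar ''A'' \<^bold>@ Var ''ys'') \<^bold>@ (l2v \<^bold>\<cdot> TVar ''A'' \<^bold>@ Var ''ys'')))"

end

theory Submission
  imports Defs
begin

text \<open>
  Modulo \<open>\<eta>\<close>, both coercions erase to the identity, so \<open>appendL\<close> erases to an \<open>\<eta>\<close>-expansion of the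
  erasure of \<open>appendV\<close>. For this expansion to be an \<open>\<eta>\<close>-redex the erasure of \<open>appendV\<close> must be
  closed. Closedness of \<open>appendV\<close> alone does not give that, since a variable bound by an implicit
  abstraction could become free when the binder is erased; typing excludes it.
\<close>

text \<open>\<open>SOME\<close> yields a fresh name only if one exists; strings are infinite, so
  finiteness of \<open>C\<close> suffices.\<close>

lemma variant_notin:
  assumes "finite C"
  shows "variant x C \<notin> C"
proof -
  have "\<exists>y. y \<notin> C"
    using assms infinite_UNIV_listI ex_new_if_finite by blast
  then have "(SOME y. y \<notin> C) \<notin> C"
    by (rule someI_ex)
  then show ?thesis
    by (simp add: variant_def)
qed

lemma finite_fv:
  shows "finite (fv_trm t)" and "finite (fv_typ T)" and "finite (fv_knd \<kappa>)"
  by (induction t and T and \<kappa>) auto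

lemma finite_img: "finite V \<Longrightarrow> finite (img V \<sigma> \<tau>)"
  by (auto simp: img_def finite_fv split: var.split)

lemma tm_variant_notin:
  assumes "finite C"
  shows "TmV (tm_variant x C) \<notin> C"
proof -
  have "finite {y. TmV y \<in> C}"
    using finite_vimageI[OF assms, of TmV] by (simp add: vimage_def inj_def)
  then show ?thesis
    using variant_notin unfolding tm_variant_def by blast
qed

text \<open>Erasure can free a variable only by dropping an implicit binder, and
  \<open>well_erased\<close> says that such a variable does not survive in the body.\<close>

lemma fv_lam_erase_subset: "well_erased t \<Longrightarrow> TmV ` fv_lam \<^bold>|t\<^bold>| \<subseteq> fv_trm t"
  by (induction t rule: trm.induct[where ?P2.0 = "\<lambda>_. True" and ?P3.0 = "\<lambda>_. True"]) auto

text \<open>The new binder avoids the images of annotated free variables; \<open>well_erased\<close>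
  puts the erased ones among them, so no capture happens after erasure either.\<close>

lemma rename_binder_fresh:
  assumes "z \<in> fv_lam \<^bold>|t\<^bold>|" and "z \<noteq> x" and "well_erased t"
  shows "r z \<noteq> tm_variant x (img (fv_trm t - {TmV x}) (\<lambda>z. Var (r z)) \<tau>)"
proof -
  have "TmV z \<in> fv_trm t - {TmV x}"
    using fv_lam_erase_subset[OF assms(3)] assms(1,2) by auto
  then have "TmV (r z) \<in> img (fv_trm t - {TmV x}) (\<lambda>z. Var (r z)) \<tau>"
    unfolding img_def by force
  then show ?thesis
    using tm_variant_notin[OF finite_img] finite_fv(1) by (metis finite_Diff)
qed

text \<open>Under a binder the substitution is again a renaming, so the induction hypothesis
  applies.\<close>

lemma Var_fun_upd: "(\<lambda>z. Var (r z))(x := Var y) = (\<lambda>z. Var ((r(x := y)) z))"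
  by auto

text \<open>
  The hypothesis concerns the renamed term because the typing rules for binders only look at a
  renamed body.
\<close>

lemma well_erased_rename:
  assumes "well_erased (sub_trm t (\<lambda>z. Var (r z)) \<tau>)"
  shows "well_erased t \<and> fv_lam \<^bold>|sub_trm t (\<lambda>z. Var (r z)) \<tau>\<^bold>| = r ` fv_lam \<^bold>|t\<^bold>|"
  using assms
proof (induction t arbitrary: r \<tau>
    rule: trm.induct[where ?P2.0 = "\<lambda>_. True" and ?P3.0 = "\<lambda>_. True"])
  case (Lam x t)
  let ?y = "tm_variant x (img (fv_trm t - {TmV x}) (\<lambda>z. Var (r z)) \<tau>)"
  have we: "well_erased (sub_trm t (\<lambda>z. Var ((r(x := ?y)) z)) \<tau>)"
    using Lam.prems by (simp_all only: sub_trm.simps Let_def well_erased.simps Var_fun_upd)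
  have IH: "well_erased t"
    "fv_lam \<^bold>|sub_trm t (\<lambda>z. Var ((r(x := ?y)) z)) \<tau>\<^bold>| = (r(x := ?y)) ` fv_lam \<^bold>|t\<^bold>|"
    using Lam.IH[OF we] by blast+
  \<comment> \<open>Removing \<open>?y\<close> deletes just the image of \<open>x\<close>: by
    freshness no other variable is sent to \<open>?y\<close>.\<close>
  have "(r(x := ?y)) ` fv_lam \<^bold>|t\<^bold>| - {?y} = r ` (fv_lam \<^bold>|t\<^bold>| - {x})"
    using rename_binder_fresh[OF _ _ IH(1), of _ x r \<tau>] by (auto simp: image_iff)
  then show ?case
    using IH by (simp only: sub_trm.simps Let_def well_erased.simps erase.simps fv_lam.simps
        Var_fun_upd)
next
  case (ILam x t)
  let ?y = "tm_variant x (img (fv_trm t - {TmV x}) (\<lambda>z. Var (r z)) \<tau>)"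
  have we: "well_erased (sub_trm t (\<lambda>z. Var ((r(x := ?y)) z)) \<tau>)"
    and y: "?y \<notin> fv_lam \<^bold>|sub_trm t (\<lambda>z. Var ((r(x := ?y)) z)) \<tau>\<^bold>|"
    using ILam.prems by (simp_all only: sub_trm.simps Let_def well_erased.simps Var_fun_upd simp_thms)
  have IH: "well_erased t"
    "fv_lam \<^bold>|sub_trm t (\<lambda>z. Var ((r(x := ?y)) z)) \<tau>\<^bold>| = (r(x := ?y)) ` fv_lam \<^bold>|t\<^bold>|"
    using ILam.IH[OF we] by blast+
  \<comment> \<open>An occurrence of \<open>x\<close> would reappear as \<open>?y\<close>. The
    equation on free variables is part of the induction claim for this step.\<close>
  have x: "x \<notin> fv_lam \<^bold>|t\<^bold>|"
    using y unfolding IH(2) by (auto simp: image_iff)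
  then have "(r(x := ?y)) ` fv_lam \<^bold>|t\<^bold>| = r ` fv_lam \<^bold>|t\<^bold>|"
    by (auto simp: image_iff)
  then show ?case
    using IH x by (simp only: sub_trm.simps Let_def well_erased.simps erase.simps
        Var_fun_upd) simp
qed (auto simp: Let_def)

lemma well_erased_rename_tm: "well_erased t[Var y/x]\<^sub>e \<Longrightarrow> well_erased t"
  using well_erased_rename[of t "id(x := y)" TVar] Var_fun_upd[of id x y]
  by (simp add: id_def)

lemma well_erased_subst_ty: "well_erased t[S/X]\<^sub>E \<Longrightarrow> well_erased t"
  using well_erased_rename[of t id "TVar(X := S)"] by simp

text \<open>\<open>ty_ILam\<close> and \<open>ty_BetaAt\<close> carry the needed conditions as
  premises; at binders the property is pulled back from the renamed body.\<close>

lemma typing_well_erased: "\<Gamma> \<turnstile> t \<^bold>:\<^sub>t T \<Longrightarrow> well_erased t"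
  by (induction rule: wf_ctx_wf_knd_kinding_typing.inducts(4)
      [where ?P1.0 = "\<lambda>_. True" and ?P2.0 = "\<lambda>_ _. True" and ?P3.0 = "\<lambda>_ _ _. True"])
    (auto intro: well_erased_rename_tm well_erased_subst_ty)

lemma fv_lam_erase_closed:
  assumes "closed t" and "\<Gamma> \<turnstile> t \<^bold>:\<^sub>t T"
  shows "fv_lam \<^bold>|t\<^bold>| = {}"
  using fv_lam_erase_subset[OF typing_well_erased[OF assms(2)]] assms(1)
  by (simp add: closed_def)

declare abe_trans [trans]

lemma abe_app_id: "t =\<^sub>\<alpha>\<^sub>\<beta>\<^sub>\<eta> LLam x (LVar x) \<Longrightarrow> LApp t u =\<^sub>\<alpha>\<^sub>\<beta>\<^sub>\<eta> u"
  using abe_trans[OF abe_app[OF _ abe_refl] abe_beta[of x "LVar x" u]] by simp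

lemma abe_eta2:
  assumes "x \<noteq> y" and "x \<notin> fv_lam t" and "y \<notin> fv_lam t"
  shows "LLam x (LLam y (LApp (LApp t (LVar x)) (LVar y))) =\<^sub>\<alpha>\<^sub>\<beta>\<^sub>\<eta> t"
proof -
  have "LLam x (LLam y (LApp (LApp t (LVar x)) (LVar y))) =\<^sub>\<alpha>\<^sub>\<beta>\<^sub>\<eta> LLam x (LApp t (LVar x))"
    using assms by (intro abe_lam abe_eta) simp
  also have "\<dots> =\<^sub>\<alpha>\<^sub>\<beta>\<^sub>\<eta> t"
    using assms by (intro abe_eta)
  finally show ?thesis .
qed

text \<open>This is the erased shape of \<open>v2l\<close> and \<open>l2v\<close>: \<open>s\<close>
  comes from \<open>mkList\<close> or \<open>mkVec\<close>, \<open>t\<close> from the first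
  component of the pair.\<close>

lemma abe_id_id_app:
  assumes "s =\<^sub>\<alpha>\<^sub>\<beta>\<^sub>\<eta> LLam x (LVar x)" and "t =\<^sub>\<alpha>\<^sub>\<beta>\<^sub>\<eta> LLam x (LVar x)"
  shows "LLam x (LApp s (LApp t (LVar x))) =\<^sub>\<alpha>\<^sub>\<beta>\<^sub>\<eta> LLam x (LVar x)"
  using assms by (intro abe_lam) (rule abe_trans[OF abe_app_id abe_app_id])

lemma erase_v2lC: "\<^bold>|v2lC\<^bold>| =\<^sub>\<alpha>\<^sub>\<beta>\<^sub>\<eta> LLam ''xs'' (LVar ''xs'')"
  by (simp add: v2lC_def) (intro abe_lam abe_eta2; simp)

lemma erase_v2l: "\<^bold>|v2l\<^bold>| =\<^sub>\<alpha>\<^sub>\<beta>\<^sub>\<eta> LLam ''xs'' (LVar ''xs'')"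
  by (simp add: v2l_def mkList_def) (intro abe_id_id_app erase_v2lC abe_refl)

lemma erase_l2vC: "\<^bold>|l2vC\<^bold>| =\<^sub>\<alpha>\<^sub>\<beta>\<^sub>\<eta> LLam ''xs'' (LVar ''xs'')"
proof -
  \<comment> \<open>This is \<open>elimList\<close> applied to \<open>xs\<close> after erasure:
    \<open>\<rho>\<close>, the projections and the implicit arguments vanish.\<close>
  let ?elim = "LApp (LLam ''xs'' (LVar ''xs'')) (LVar ''xs'')"
  have "\<^bold>|l2vC\<^bold>| =\<^sub>\<alpha>\<^sub>\<beta>\<^sub>\<eta> LLam ''xs'' ?elim"
    by (simp add: l2vC_def elimList_def) (intro abe_lam abe_eta2; simp)
  also have "\<dots> =\<^sub>\<alpha>\<^sub>\<beta>\<^sub>\<eta> LLam ''xs'' (LVar ''xs'')"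
    by (intro abe_lam abe_app_id[OF abe_refl])
  finally show ?thesis .
qed

lemma erase_l2v: "\<^bold>|l2v\<^bold>| =\<^sub>\<alpha>\<^sub>\<beta>\<^sub>\<eta> LLam ''xs'' (LVar ''xs'')"
  by (simp add: l2v_def mkVec_def) (intro abe_id_id_app erase_l2vC abe_refl)

theorem theorem3p8:
  fixes appendV :: trm
  assumes "closed appendV"
    and "[] \<turnstile> appendV \<^bold>:\<^sub>t
      (\<^bold>\<forall>\<^sub>T''A''\<^bold>:\<^bold>\<star>. \<^bold>\<forall>''n''\<^bold>:NatT. VecT \<^bold>\<cdot>\<^sub>T TVar ''A'' \<^bold>@\<^sub>t Var ''n'' \<^bold>\<rightarrow>
        (\<^bold>\<forall>''m''\<^bold>:NatT. VecT \<^bold>\<cdot>\<^sub>T TVar ''A'' \<^bold>@\<^sub>t Var ''m'' \<^bold>\<rightarrow>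
          VecT \<^bold>\<cdot>\<^sub>T TVar ''A'' \<^bold>@\<^sub>t (addN \<^bold>@ Var ''n'' \<^bold>@ Var ''m'')))"
  shows "\<^bold>|appendL appendV\<^bold>| =\<^sub>\<alpha>\<^sub>\<beta>\<^sub>\<eta> \<^bold>|appendV\<^bold>|"
proof -
  have fv: "fv_lam \<^bold>|appendV\<^bold>| = {}"
    by (rule fv_lam_erase_closed[OF assms])
  have "LLam ''xs'' (LLam ''ys'' (LApp \<^bold>|v2l\<^bold>|
      (LApp (LApp \<^bold>|appendV\<^bold>| (LApp \<^bold>|l2v\<^bold>| (LVar ''xs''))) (LApp \<^bold>|l2v\<^bold>| (LVar ''ys'')))))
      =\<^sub>\<alpha>\<^sub>\<beta>\<^sub>\<eta> LLam ''xs'' (LLam ''ys''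
      (LApp (LApp \<^bold>|appendV\<^bold>| (LApp \<^bold>|l2v\<^bold>| (LVar ''xs''))) (LApp \<^bold>|l2v\<^bold>| (LVar ''ys''))))"
    by (intro abe_lam abe_app_id[OF erase_v2l])
  also have "\<dots> =\<^sub>\<alpha>\<^sub>\<beta>\<^sub>\<eta> LLam ''xs'' (LLam ''ys''
      (LApp (LApp \<^bold>|appendV\<^bold>| (LVar ''xs'')) (LVar ''ys'')))"
    by (intro abe_lam abe_app abe_refl abe_app_id[OF erase_l2v])
  \<comment> \<open>Both bound names are absent from the erasure because it has no free
    variables.\<close>
  also have "\<dots> =\<^sub>\<alpha>\<^sub>\<beta>\<^sub>\<eta> \<^bold>|appendV\<^bold>|"
    by (rule abe_eta2) (simp_all add: fv)
  finally show ?thesis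
    by (simp add: appendL_def)
qed

end
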